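(* Let $n \in \mathbb{N}$, let $u', v' \in \{0,1\}^n$ be distinct words, and let $G' = \langle c^0, f_{u',v'}, \sigma \rangle$. Then $G = G'$ if and only if $d(u', v') \in 0^*0100^*$, i.e. $d(u',v') = 0^a 1 0^b$ for some $a, b \geq 1$ (the words $u'$ and $v'$ differ in exactly one coordinate, which is neither the first nor the last).
   Context: Let $X = \{0,1\}^{\mathbb{Z}}$ with the product topology (discrete topology on $\{0,1\}$). The shift $\sigma : X \to X$ is $\sigma(x)_i = x_{i+1}$. The group $G$ is the subgroup of the self-homeomorphism group of $X$ (under composition) generated by $\sigma$ and all homeomorphisms $f : X \to X$ for which there exists $r$ such that $f(x)_i = x_i$ for all $x \in X$ and all $|i| \geq r$. The notation $\langle \cdots \rangle$ denotes the subgroup of $G$ generated by the listed elements. The flip $c^0 \in G$ is the map with $c^0(x)_0 = 1 - x_0$ and $c^0(x)_i = x_i$ for $i \neq 0$. For words $u, v \in \{0,1\}^n$ (indexed by $0, \dots, n-1$), $d(u,v) \in \{0,1\}^n$ is the word whose $i$th letter is $1$ if $u_i \neq v_i$ and $0$ if $u_i = v_i$. The map $f_{u,v} \in G$ is defined by: $f_{u,v}(x)_{[0,n-1]} = v$ if $x_{[0,n-1]} = u$; $f_{u,v}(x)_{[0,n-1]} = u$ if $x_{[0,n-1]} = v$; $f_{u,v}(x)_{[0,n-1]} = x_{[0,n-1]}$ otherwise; and $f_{u,v}(x)_i = x_i$ for $i \notin [0,n-1]$. *)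

theory Defs
  imports "HOL-Analysis.Analysis" "HOL-Algebra.Generated_Groups"
begin

text \<open>The letters 0 and 1 are represented by \<^const>\<open>False\<close> and \<^const>\<open>True\<close>.\<close>

type_synonym config = "int \<Rightarrow> bool"

definition full_shift :: "config topology" where
  "full_shift = product_topology (\<lambda>_. discrete_topology UNIV) UNIV"

definition homeo_group :: "(config \<Rightarrow> config) monoid" where
  "homeo_group =
     \<lparr>carrier = {f. homeomorphic_map full_shift full_shift f}, mult = (\<circ>), one = id\<rparr>"

definition shift :: "config \<Rightarrow> config" where
  "shift x = (\<lambda>i. x (i + 1))"

text \<open>Only the set of modified coordinates is bounded a priori; the new values may depend
  on the whole configuration.\<close>

definition local_homeos :: "(config \<Rightarrow> config) set" where
  "local_homeos = {f \<in> carrier homeo_group. \<exists>r::nat. \<forall>x i. \<bar>i\<bar> \<ge> int r \<longrightarrow> f x i = x i}"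

definition G_group :: "(config \<Rightarrow> config) monoid" where
  "G_group = homeo_group\<lparr>carrier := generate homeo_group (insert shift local_homeos)\<rparr>"

definition flip0 :: "config \<Rightarrow> config" where
  "flip0 x = x(0 := \<not> x 0)"

definition diff_word :: "bool list \<Rightarrow> bool list \<Rightarrow> bool list" where
  "diff_word u v = map2 (\<noteq>) u v"

definition window :: "nat \<Rightarrow> config \<Rightarrow> bool list" where
  "window n x = map (\<lambda>i. x (int i)) [0..<n]"

definition put_word :: "bool list \<Rightarrow> config \<Rightarrow> config" where
  "put_word w x = (\<lambda>i. if 0 \<le> i \<and> i < int (length w) then w ! nat i else x i)"

text \<open>The following is meaningful for words \<open>u\<close> and \<open>v\<close> of equal length.\<close>

definition swap_words :: "bool list \<Rightarrow> bool list \<Rightarrow> config \<Rightarrow> config" where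
  "swap_words u v x =
     (if window (length u) x = u then put_word v x
      else if window (length u) x = v then put_word u x
      else x)"

subsection \<open>Well-formedness of the groups and of the listed elements\<close>

lemma topspace_full_shift [simp]: "topspace full_shift = UNIV"
  by (simp add: full_shift_def)

lemma group_homeo_group: "group homeo_group"
proof (rule groupI)
  fix f assume "f \<in> carrier homeo_group"
  then obtain g where "homeomorphic_maps full_shift full_shift f g"
    by (auto simp: homeo_group_def homeomorphic_map_maps)
  then have "homeomorphic_map full_shift full_shift g" "g \<circ> f = id"
    by (auto simp: homeomorphic_maps_map fun_eq_iff)
  then show "\<exists>g\<in>carrier homeo_group. g \<otimes>\<^bsub>homeo_group\<^esub> f = \<one>\<^bsub>homeo_group\<^esub>"
    by (auto simp: homeo_group_def)
qed (auto simp: homeo_group_def comp_assoc intro: homeomorphic_map_compose)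

lemma continuous_map_full_shiftI:
  assumes fin: "\<And>i. finite (N i)"
    and dep: "\<And>i x y. (\<And>j. j \<in> N i \<Longrightarrow> x j = y j) \<Longrightarrow> f x i = f y i"
  shows "continuous_map full_shift full_shift f"
proof -
  have "continuous_map full_shift (discrete_topology UNIV) (\<lambda>x. f x i)" for i
  proof -
    have "openin full_shift {x. f x i \<in> U}" for U
      unfolding full_shift_def openin_product_topology_alt
    proof
      fix x assume x: "x \<in> {x. f x i \<in> U}"
      define W where "W = (\<lambda>j. if j \<in> N i then {x j} else UNIV)"
      have "finite {j \<in> UNIV. W j \<noteq> topspace (discrete_topology UNIV)}"
        by (rule finite_subset[OF _ fin[of i]]) (auto simp: W_def)
      moreover have "Pi\<^sub>E UNIV W \<subseteq> {x. f x i \<in> U}"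
      proof
        fix y assume "y \<in> Pi\<^sub>E UNIV W"
        then have "y j \<in> W j" for j by auto
        then have "y j = x j" if "j \<in> N i" for j
          using that by (metis W_def singletonD)
        then have "f y i = f x i" by (rule dep)
        then show "y \<in> {x. f x i \<in> U}" using x by simp
      qed
      ultimately show "\<exists>W. finite {j \<in> UNIV. W j \<noteq> topspace (discrete_topology UNIV)} \<and>
          (\<forall>j\<in>UNIV. openin (discrete_topology UNIV) (W j)) \<and>
          x \<in> Pi\<^sub>E UNIV W \<and> Pi\<^sub>E UNIV W \<subseteq> {x. f x i \<in> U}"
        by (intro exI[of _ W]) (auto simp: W_def)
    qed
    then show ?thesis by (simp add: continuous_map_def)
  qed
  then show ?thesis
    unfolding full_shift_def by (simp add: continuous_map_componentwise_UNIV)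
qed

lemma shift_in_homeo_group: "shift \<in> carrier homeo_group"
proof -
  have "homeomorphic_maps full_shift full_shift shift (\<lambda>x i. x (i - 1))"
    unfolding homeomorphic_maps_def
  proof (intro conjI)
    show "continuous_map full_shift full_shift shift"
      by (rule continuous_map_full_shiftI[where N = "\<lambda>i. {i + 1}"]) (simp_all add: shift_def)
    show "continuous_map full_shift full_shift (\<lambda>x i. x (i - 1))"
      by (rule continuous_map_full_shiftI[where N = "\<lambda>i. {i - 1}"]) simp_all
  qed (simp_all add: shift_def)
  then show ?thesis
    by (auto simp: homeo_group_def homeomorphic_map_maps)
qed

lemma group_G_group: "group G_group"
proof -
  have "insert shift local_homeos \<subseteq> carrier homeo_group"
    by (auto simp: local_homeos_def shift_in_homeo_group)
  then have "subgroup (generate homeo_group (insert shift local_homeos)) homeo_group"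
    by (rule group.generate_is_subgroup[OF group_homeo_group])
  then show ?thesis
    unfolding G_group_def by (rule subgroup.subgroup_is_group[OF _ group_homeo_group])
qed

lemma shift_in_G_group: "shift \<in> carrier G_group"
  by (auto simp: G_group_def intro: generate.incl)

lemma local_in_G_group: "f \<in> local_homeos \<Longrightarrow> f \<in> carrier G_group"
  by (auto simp: G_group_def intro: generate.incl)

lemma flip0_in_G_group: "flip0 \<in> carrier G_group"
proof -
  have "homeomorphic_map full_shift full_shift flip0"
    by (rule homeomorphic_map_involution,
        rule continuous_map_full_shiftI[where N = "\<lambda>i. {i}"]) (auto simp: flip0_def)
  then have "flip0 \<in> local_homeos"
    by (auto simp: local_homeos_def homeo_group_def flip0_def intro!: exI[of _ "Suc 0"])
  then show ?thesis by (rule local_in_G_group)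
qed

lemma window_put_word: "length w = n \<Longrightarrow> window n (put_word w x) = w"
  by (rule nth_equalityI) (auto simp: window_def put_word_def)

lemma put_word_put_word: "length w = length w' \<Longrightarrow> put_word w (put_word w' x) = put_word w x"
  by (auto simp: put_word_def)

lemma put_word_window:
  assumes "window (length w) x = w"
  shows "put_word w x = x"
proof
  fix i
  have "w ! nat i = x i" if "0 \<le> i" "i < int (length w)"
    using that arg_cong[OF assms, of "\<lambda>w. w ! nat i"] by (simp add: window_def nat_less_iff)
  then show "put_word w x i = x i"
    by (simp add: put_word_def)
qed

lemma swap_words_in_G_group:
  assumes "length u = length v"
  shows "swap_words u v \<in> carrier G_group"
proof -
  let ?n = "length v"
  have "continuous_map full_shift full_shift (swap_words u v)"
  proof (rule continuous_map_full_shiftI[where N = "\<lambda>i. insert i {0..<int ?n}"])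
    fix i and x y :: config
    assume eq: "\<And>j. j \<in> insert i {0..<int ?n} \<Longrightarrow> x j = y j"
    have "window ?n x = window ?n y"
      by (simp add: window_def eq)
    moreover have "x i = y i"
      by (simp add: eq)
    then have "put_word w x i = put_word w y i" for w
      unfolding put_word_def by presburger
    ultimately show "swap_words u v x i = swap_words u v y i"
      unfolding swap_words_def assms using \<open>x i = y i\<close> by presburger
  qed simp
  moreover have "swap_words u v (swap_words u v x) = x" for x
  proof -
    have "window ?n (put_word v x) = v" "window ?n (put_word u x) = u"
      "put_word u (put_word v x) = put_word u x" "put_word v (put_word u x) = put_word v x"
      using assms by (simp_all add: window_put_word put_word_put_word)
    moreover have "put_word u x = x" if "window ?n x = u"
      using that assms by (intro put_word_window) metis
    moreover have "put_word v x = x" if "window ?n x = v"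
      using that by (rule put_word_window)
    ultimately show ?thesis
      unfolding swap_words_def assms by presburger
  qed
  ultimately have "homeomorphic_map full_shift full_shift (swap_words u v)"
    by (intro homeomorphic_map_involution) auto
  then have "swap_words u v \<in> local_homeos"
  proof -
    have "swap_words u v x i = x i" if "\<bar>i\<bar> \<ge> int ?n" for x i
    proof -
      have "\<not> (0 \<le> i \<and> i < int ?n)" using that by linarith
      then show ?thesis unfolding swap_words_def put_word_def assms by presburger
    qed
    with \<open>homeomorphic_map full_shift full_shift (swap_words u v)\<close> show ?thesis
      by (auto simp: local_homeos_def homeo_group_def)
  qed
  then show ?thesis by (rule local_in_G_group)
qed

end

(* Read configurations as formal Laurent series over the field with two elements. Every swap of u and
   v changes a configuration by a translate of d(u,v), so modulo the ideal generated by d(u,v) each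
   element of G' acts as x |-> t^k x + c. A controlled NOT does so only if the ideal is everything,
   that is, if d(u,v) is a monomial. If the differing coordinate is the first or the last one, all
   generators are controlled from one side only, and so up to a translation the elements of G'
   respect agreement of configurations on half-lines; a controlled NOT in the other direction does not.

   Conversely, if u and v differ in a single interior coordinate, conjugating by flips and multiplying
   gives the flips controlled by any pattern on the two neighbours. The commutator of a flip of t
   controlled by A and a flip of s controlled by t and B is a flip of s controlled by A and B, which
   yields flips with arbitrary finite control sets. They are the transpositions along the edges of a
   hypercube and generate all permutations of the words on a finite window; by compactness every
   homeomorphism changing boundedly many coordinates is such a permutation. *)

theory Submission
  imports Defs "HOL-Combinatorics.Permutations"
begin

section \<open>Translations and controlled flips\<close>

definition translate :: "int \<Rightarrow> config \<Rightarrow> config" where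
  "translate k x = (\<lambda>i. x (i + k))"

text \<open>The pattern is a whole configuration of which only the values on \<open>C\<close>
  matter, so the control set can vary while \<open>w\<close> stays the same.\<close>

definition agree :: "config \<Rightarrow> int set \<Rightarrow> config \<Rightarrow> bool" where
  "agree w C x \<longleftrightarrow> (\<forall>j\<in>C. x j = w j)"

definition toggle_if :: "int \<Rightarrow> (config \<Rightarrow> bool) \<Rightarrow> config \<Rightarrow> config" where
  "toggle_if i P x = x(i := (x i \<noteq> P x))"

lemma shift_eq_translate: "shift = translate 1"
  by (auto simp: shift_def translate_def)

lemma flip0_eq_toggle_if: "flip0 = toggle_if 0 (\<lambda>_. True)"
  by (auto simp: flip0_def toggle_if_def)

lemma translate_translate: "translate k (translate l x) = translate (k + l) x"
  by (simp add: translate_def add.assoc)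

lemma translate_0: "translate 0 = id"
  by (auto simp: translate_def)

lemma agree_upd: "a \<notin> C \<Longrightarrow> agree w C (x(a := b)) = agree w C x"
  by (auto simp: agree_def)

lemma agree_cong: "(\<And>j. j \<in> C \<Longrightarrow> x j = y j) \<Longrightarrow> agree w C x = agree w C y"
  by (auto simp: agree_def)

lemma toggle_if_involution:
  "a \<notin> C \<Longrightarrow> toggle_if a (agree w C) (toggle_if a (agree w C) x) = x"
  by (auto simp: toggle_if_def agree_upd fun_eq_iff)

lemma toggle_if_local_homeo:
  assumes "finite C" "a \<notin> C"
  shows "toggle_if a (agree w C) \<in> local_homeos"
proof -
  have "continuous_map full_shift full_shift (toggle_if a (agree w C))"
  proof (rule continuous_map_full_shiftI[where N = "\<lambda>i. insert i C"])
    fix i and x y :: config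
    assume eq: "\<And>j. j \<in> insert i C \<Longrightarrow> x j = y j"
    then have "agree w C x = agree w C y"
      by (auto simp: agree_def)
    with eq show "toggle_if a (agree w C) x i = toggle_if a (agree w C) y i"
      by (auto simp: toggle_if_def)
  qed (simp add: assms)
  then have "homeomorphic_map full_shift full_shift (toggle_if a (agree w C))"
    using assms by (intro homeomorphic_map_involution) (auto simp: toggle_if_involution)
  then show ?thesis
    unfolding local_homeos_def homeo_group_def
    by (simp, intro exI[of _ "Suc (nat \<bar>a\<bar>)"]) (auto simp: toggle_if_def)
qed

lemma window_eq_iff: "length w = n \<Longrightarrow> window n x = w \<longleftrightarrow> (\<forall>i<n. x (int i) = w ! i)"
  by (auto simp: window_def list_eq_iff_nth_eq)

text \<open>If the words differ only at \<open>a\<close>, the window reads one of them exactly when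
  it agrees with \<open>u\<close> off \<open>a\<close>, and exchanging them negates the letter at
  \<open>a\<close>.\<close>

lemma swap_words_eq_toggle_if:
  assumes len: "length u = n" "length v = n" and a: "a < n"
    and diff: "\<forall>i<n. (u ! i \<noteq> v ! i) = (i = a)"
  shows "swap_words u v = toggle_if (int a) (agree (\<lambda>i. u ! nat i) ({0..<int n} - {int a}))"
proof
  fix x
  let ?w = "\<lambda>i. u ! nat i" and ?C = "{0..<int n} - {int a}"
  have ag: "agree ?w ?C x \<longleftrightarrow> (\<forall>i<n. i \<noteq> a \<longrightarrow> x (int i) = u ! i)"
  proof
    assume "agree ?w ?C x"
    then show "\<forall>i<n. i \<noteq> a \<longrightarrow> x (int i) = u ! i"
      by (auto simp: agree_def)
  next
    assume R: "\<forall>i<n. i \<noteq> a \<longrightarrow> x (int i) = u ! i"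
    show "agree ?w ?C x"
      unfolding agree_def
    proof
      fix j assume "j \<in> ?C"
      then have "nat j < n" "nat j \<noteq> a" "int (nat j) = j" by auto
      with R show "x j = u ! nat j" by metis
    qed
  qed
  have wu: "window n x = u \<longleftrightarrow> agree ?w ?C x \<and> x (int a) = u ! a"
    unfolding window_eq_iff[OF len(1)] ag using a by auto
  have wv: "window n x = v \<longleftrightarrow> agree ?w ?C x \<and> x (int a) \<noteq> u ! a"
    unfolding window_eq_iff[OF len(2)] ag using a diff by metis
  have put: "put_word w x = x(int a := w ! a)"
    if "agree ?w ?C x" "length w = n" "\<And>i. i < n \<Longrightarrow> i \<noteq> a \<Longrightarrow> w ! i = u ! i" for w
  proof
    fix i
    show "put_word w x i = (x(int a := w ! a)) i"
    proof (cases "0 \<le> i \<and> i < int n")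
      case True
      then have i: "nat i < n" "int (nat i) = i" by auto
      have "put_word w x i = w ! nat i"
        using True that(2) by (simp add: put_word_def)
      moreover have "w ! nat i = (x(int a := w ! a)) i"
      proof (cases "nat i = a")
        case False
        have "x (int (nat i)) = u ! nat i" using that(1) ag i False by blast
        with False i that(3)[of "nat i"] show ?thesis by auto
      qed (use i in auto)
      ultimately show ?thesis by simp
    next
      case False
      then show ?thesis using a that by (auto simp: put_word_def)
    qed
  qed
  show "swap_words u v x = toggle_if (int a) (agree ?w ?C) x"
  proof (cases "agree ?w ?C x")
    case True
    have "put_word v x = x(int a := v ! a)"
      by (rule put[OF True len(2)]) (use diff in blast)
    moreover have "v ! a = (\<not> u ! a)" using diff a by blast
    moreover have "put_word u x = x(int a := u ! a)"
      using put[OF True len(1)] by blast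
    ultimately show ?thesis
      using True wu wv len by (auto simp: swap_words_def toggle_if_def)
  next
    case False
    then show ?thesis using wu wv len by (simp add: swap_words_def toggle_if_def)
  qed
qed

section \<open>Inverses of the generators\<close>

lemma homeo_group_simps:
  "mult homeo_group = (\<circ>)" "one homeo_group = id"
  by (simp_all add: homeo_group_def)

lemma G_group_simps:
  "mult G_group = (\<circ>)" "one G_group = id"
  by (simp_all add: G_group_def homeo_group_def)

lemma G_group_subset_homeo_group: "carrier G_group \<subseteq> carrier homeo_group"
  using group.generate_incl[OF group_homeo_group, of "insert shift local_homeos"]
  by (auto simp: G_group_def local_homeos_def shift_in_homeo_group)

text \<open>The group contains a left inverse of \<open>shift\<close>, and surjectivity of
  \<open>shift\<close> determines it completely.\<close>

lemma translate_neg_one_in_G_group: "translate (-1) \<in> carrier G_group"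
  and inv_shift: "inv\<^bsub>G_group\<^esub> shift = translate (-1)"
proof -
  interpret group G_group by (rule group_G_group)
  obtain g where g: "g \<in> carrier G_group" "g \<circ> shift = id"
    using l_inv_ex[OF shift_in_G_group] by (auto simp: G_group_simps)
  have "g x = translate (-1) x" for x
  proof -
    have "g (shift (translate (-1) x)) = translate (-1) x"
      using g(2) by (metis comp_apply id_apply)
    then show ?thesis by (simp add: shift_eq_translate translate_translate translate_0)
  qed
  then have "g = translate (-1)" by auto
  with g show "translate (-1) \<in> carrier G_group" by simp
  then show "inv\<^bsub>G_group\<^esub> shift = translate (-1)"
    by (intro inv_equality)
      (auto simp: G_group_simps shift_eq_translate translate_translate translate_0 shift_in_G_group[unfolded shift_eq_translate])
qed

lemma swap_words_involution:
  assumes "length u = length v"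
  shows "swap_words u v (swap_words u v x) = x"
proof -
  have "window (length v) (put_word v x) = v" "window (length v) (put_word u x) = u"
    using assms by (simp_all add: window_put_word)
  moreover have "put_word u x = x" if "window (length v) x = u"
    using that assms by (intro put_word_window) metis
  moreover have "put_word v x = x" if "window (length v) x = v"
    using that by (rule put_word_window)
  moreover have "put_word u (put_word v x) = put_word u x" "put_word v (put_word u x) = put_word v x"
    using assms by (simp_all add: put_word_put_word)
  ultimately show ?thesis
    unfolding swap_words_def assms by presburger
qed

lemma inv_G_group_involution:
  assumes "f \<in> carrier G_group" "\<And>x. f (f x) = x"
  shows "inv\<^bsub>G_group\<^esub> f = f"
  using assms by (intro group.inv_equality[OF group_G_group]) (auto simp: G_group_simps)

text \<open>Of the generators only \<open>shift\<close> is not an involution, so its inverse is the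
  only one that needs a case of its own.\<close>

lemma generate_flip_swap_shift_induct [consumes 2, case_names id flip0 swap shift unshift comp]:
  assumes g: "g \<in> generate G_group {flip0, swap_words u v, shift}" and len: "length u = length v"
    and "P id" "P flip0" "P (swap_words u v)" "P (translate 1)" "P (translate (-1))"
    and "\<And>g h. P g \<Longrightarrow> P h \<Longrightarrow> P (g \<circ> h)"
  shows "P g"
  using g
proof (induction rule: generate.induct)
  case one
  show ?case unfolding G_group_simps by fact
next
  case (incl h)
  then show ?case using assms by (auto simp: shift_eq_translate)
next
  case (inv h)
  have "inv\<^bsub>G_group\<^esub> flip0 = flip0"
    by (rule inv_G_group_involution[OF flip0_in_G_group]) (auto simp: flip0_def)
  moreover have "inv\<^bsub>G_group\<^esub> swap_words u v = swap_words u v"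
    by (rule inv_G_group_involution[OF swap_words_in_G_group[OF len] swap_words_involution[OF len]])
  ultimately show ?case using inv assms by (auto simp: inv_shift)
next
  case (eng h1 h2)
  then show ?case unfolding G_group_simps using assms by blast
qed

section \<open>Necessity: the words differ in a single coordinate\<close>

text \<open>With configurations read as formal Laurent series over the field with two elements, this is
  congruence modulo the ideal of Laurent polynomials generated by the indicator of \<open>D\<close>; the witness
  \<open>q\<close> is the support of the cofactor.\<close>

definition ideal_cong :: "int set \<Rightarrow> config \<Rightarrow> config \<Rightarrow> bool" where
  "ideal_cong D x y \<longleftrightarrow>
     (\<exists>q. finite q \<and> (\<forall>j. (x j \<noteq> y j) = odd (card {i \<in> q. j - i \<in> D})))"

lemma ideal_cong_refl: "ideal_cong D x x"
  unfolding ideal_cong_def by (intro exI[of _ "{}"]) auto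

lemma ideal_cong_sym: "ideal_cong D x y \<Longrightarrow> ideal_cong D y x"
  unfolding ideal_cong_def by metis

text \<open>Symmetric difference of supports is addition over the field with two elements;
  transitivity of \<open>ideal_cong\<close> adds two cofactors this way.\<close>

lemma odd_card_sym_diff:
  assumes "finite A" "finite B"
  shows "odd (card ((A - B) \<union> (B - A))) = (odd (card A) \<noteq> odd (card B))"
proof -
  have "card ((A - B) \<union> (B - A)) = card (A - B) + card (B - A)"
    using assms by (intro card_Un_disjoint) auto
  moreover have "card A = card (A - B) + card (A \<inter> B)"
    using assms(1) by (metis card_Int_Diff add.commute)
  moreover have "card B = card (B - A) + card (A \<inter> B)"
    using assms(2) by (metis card_Int_Diff add.commute Int_commute)
  ultimately show ?thesis by auto
qed

lemma ideal_cong_trans: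
  assumes "ideal_cong D x y" "ideal_cong D y z"
  shows "ideal_cong D x z"
proof -
  obtain p where p: "finite p" "\<And>j. (x j \<noteq> y j) = odd (card {i \<in> p. j - i \<in> D})"
    using assms(1) unfolding ideal_cong_def by blast
  obtain q where q: "finite q" "\<And>j. (y j \<noteq> z j) = odd (card {i \<in> q. j - i \<in> D})"
    using assms(2) unfolding ideal_cong_def by blast
  have "(x j \<noteq> z j) = odd (card {i \<in> (p - q) \<union> (q - p). j - i \<in> D})" for j
  proof -
    let ?A = "{i \<in> p. j - i \<in> D}" and ?B = "{i \<in> q. j - i \<in> D}"
    have "{i \<in> (p - q) \<union> (q - p). j - i \<in> D} = (?A - ?B) \<union> (?B - ?A)" by auto
    then have "odd (card {i \<in> (p - q) \<union> (q - p). j - i \<in> D}) = ((x j \<noteq> y j) \<noteq> (y j \<noteq> z j))"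
      using odd_card_sym_diff[of ?A ?B] p q by simp
    then show ?thesis by auto
  qed
  then show ?thesis
    unfolding ideal_cong_def using p(1) q(1) by (intro exI[of _ "(p - q) \<union> (q - p)"]) auto
qed

lemma ideal_cong_translate:
  assumes "ideal_cong D x y"
  shows "ideal_cong D (translate k x) (translate k y)"
proof -
  obtain q where q: "finite q" "\<And>j. (x j \<noteq> y j) = odd (card {i \<in> q. j - i \<in> D})"
    using assms unfolding ideal_cong_def by blast
  \<comment> \<open>Translation multiplies by a monomial, so the support of the cofactor is moved
    along.\<close>
  have "card {i \<in> q. (j + k) - i \<in> D} = card {i \<in> (\<lambda>i. i - k) ` q. j - i \<in> D}" for j
    by (rule bij_betw_same_card[of "\<lambda>i. i - k"])
      (auto simp: bij_betw_def inj_on_def image_iff algebra_simps)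
  with q show ?thesis
    unfolding ideal_cong_def translate_def
    by (intro exI[of _ "(\<lambda>i. i - k) ` q"]) auto
qed

lemma ideal_cong_xor:
  "ideal_cong D x y \<Longrightarrow> ideal_cong D (\<lambda>j. x j \<noteq> c j) (\<lambda>j. y j \<noteq> c j)"
  unfolding ideal_cong_def by (elim ex_forward) auto

lemma ideal_cong_generator:
  assumes "\<And>j. (x j \<noteq> y j) = (j \<in> D)"
  shows "ideal_cong D x y"
proof -
  have "{i \<in> {0}. j - i \<in> D} = (if j \<in> D then {0} else {})" for j by auto
  with assms show ?thesis
    unfolding ideal_cong_def by (intro exI[of _ "{0}"]) auto
qed

text \<open>A nonzero multiple of the generator has its extreme terms at the sums of the extreme terms of
  the two factors, so only a monomial generates an ideal containing a monomial.\<close>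

lemma ideal_cong_single_imp_singleton:
  assumes D: "finite D" "D \<noteq> {}" and cong: "ideal_cong D x y"
    and single: "\<And>j. (x j \<noteq> y j) = (j = m)"
  shows "\<exists>a. D = {a}"
proof -
  obtain q where q: "finite q" "\<And>j. (j = m) = odd (card {i \<in> q. j - i \<in> D})"
    using cong single unfolding ideal_cong_def by blast
  have "q \<noteq> {}" using q(2)[of m] by auto
  note mm = Min_in[OF q(1) this] Max_in[OF q(1) this] Min_in[OF D] Max_in[OF D]
  \<comment> \<open>Only the product of the two lowest terms lands on this coordinate, so nothing
    cancels there.\<close>
  have "{i \<in> q. (Min q + Min D) - i \<in> D} = {Min q}"
  proof -
    have "i = Min q" if "i \<in> q" "(Min q + Min D) - i \<in> D" for i
      using Min_le[OF q(1) that(1)] Min_le[OF D(1) that(2)] by linarith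
    then show ?thesis using mm by auto
  qed
  then have 1: "Min q + Min D = m" using q(2) by simp
  have "{i \<in> q. (Max q + Max D) - i \<in> D} = {Max q}"
  proof -
    have "i = Max q" if "i \<in> q" "(Max q + Max D) - i \<in> D" for i
      using Max_ge[OF q(1) that(1)] Max_ge[OF D(1) that(2)] by linarith
    then show ?thesis using mm by auto
  qed
  then have 2: "Max q + Max D = m" using q(2) by simp
  have "Min q \<le> Max q" using mm q(1) by simp
  \<comment> \<open>The spreads of \<open>q\<close> and \<open>D\<close> add up to zero and that of
    \<open>q\<close> is nonnegative.\<close>
  with 1 2 have le: "Max D \<le> Min D" by linarith
  have "d = Min D" if "d \<in> D" for d
    using le Min_le[OF D(1) that] Max_ge[OF D(1) that] by linarith
  then show ?thesis using mm by blast
qed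

text \<open>On the quotient by the ideal, \<open>g\<close> acts as multiplication by a monomial plus
  a constant. The same \<open>k\<close> and \<open>c\<close> must serve every \<open>x\<close>; this
  uniformity is what excludes a controlled NOT.\<close>

definition affine_mod :: "int set \<Rightarrow> (config \<Rightarrow> config) \<Rightarrow> bool" where
  "affine_mod D g \<longleftrightarrow> (\<exists>k c. \<forall>x. ideal_cong D (g x) (\<lambda>j. translate k x j \<noteq> c j))"

lemma affine_modI: "(\<And>x. ideal_cong D (g x) (\<lambda>j. translate k x j \<noteq> c j)) \<Longrightarrow> affine_mod D g"
  unfolding affine_mod_def by blast

lemma affine_mod_comp:
  assumes "affine_mod D g" "affine_mod D h"
  shows "affine_mod D (g \<circ> h)"
proof -
  obtain k c where g: "\<And>x. ideal_cong D (g x) (\<lambda>j. translate k x j \<noteq> c j)"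
    using assms(1) unfolding affine_mod_def by blast
  obtain l e where h: "\<And>x. ideal_cong D (h x) (\<lambda>j. translate l x j \<noteq> e j)"
    using assms(2) unfolding affine_mod_def by blast
  show ?thesis
  proof (rule affine_modI)
    fix x
    have "ideal_cong D (\<lambda>j. translate k (h x) j \<noteq> c j)
        (\<lambda>j. translate k (\<lambda>j. translate l x j \<noteq> e j) j \<noteq> c j)"
      by (intro ideal_cong_xor ideal_cong_translate h)
    from ideal_cong_trans[OF g this]
    have "ideal_cong D (g (h x)) (\<lambda>j. translate k (\<lambda>j. translate l x j \<noteq> e j) j \<noteq> c j)" .
    moreover have "(\<lambda>j. translate k (\<lambda>j. translate l x j \<noteq> e j) j \<noteq> c j) =
        (\<lambda>j. translate (k + l) x j \<noteq> (translate k e j \<noteq> c j))"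
      by (auto simp: translate_def add.assoc)
    ultimately show "ideal_cong D ((g \<circ> h) x)
        (\<lambda>j. translate (k + l) x j \<noteq> (translate k e j \<noteq> c j))" by simp
  qed
qed

lemma affine_mod_translate: "affine_mod D (translate k)"
  by (rule affine_modI[of _ _ k "\<lambda>_. False"]) (simp add: ideal_cong_refl)

lemma affine_mod_flip0: "affine_mod D flip0"
proof (rule affine_modI[of _ _ 0 "\<lambda>j. j = 0"])
  fix x
  have "flip0 x = (\<lambda>j. translate 0 x j \<noteq> (j = 0))"
    by (auto simp: flip0_def translate_def)
  then show "ideal_cong D (flip0 x) (\<lambda>j. translate 0 x j \<noteq> (j = 0))"
    by (simp add: ideal_cong_refl)
qed

text \<open>A swap either fixes a configuration or adds the generator of the ideal to it, so it is
  the identity on the quotient.\<close>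

lemma affine_mod_swap_words:
  assumes len: "length u = n" "length v = n" and D: "D = int ` {i. i < n \<and> u ! i \<noteq> v ! i}"
  shows "affine_mod D (swap_words u v)"
proof (rule affine_modI[of _ _ 0 "\<lambda>_. False"])
  fix x
  have inD: "j \<in> D \<longleftrightarrow> 0 \<le> j \<and> j < int n \<and> u ! nat j \<noteq> v ! nat j" for j
    unfolding D by (auto simp: image_iff intro!: exI[of _ "nat j"])
  have put: "ideal_cong D (put_word w' x) x"
    if w: "window n x = w" and "{w, w'} = {u, v}" for w w'
  proof (rule ideal_cong_generator)
    fix j
    have ww: "w = u \<and> w' = v \<or> w = v \<and> w' = u" using that(2) by (auto simp: doubleton_eq_iff)
    then have l: "length w = n" "length w' = n" using len by auto
    have "x j = w ! nat j" if "0 \<le> j" "j < int n"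
      using w window_eq_iff[OF l(1)] that by (metis int_nat_eq nat_less_iff)
    then show "(put_word w' x j \<noteq> x j) = (j \<in> D)"
      unfolding inD put_word_def using ww l by auto
  qed
  have "ideal_cong D (swap_words u v x) x"
    using put[of u v] put[of v u] len
    by (auto simp: swap_words_def ideal_cong_refl)
  then show "ideal_cong D (swap_words u v x) (\<lambda>j. translate 0 x j \<noteq> False)"
    by (simp add: translate_0)
qed

text \<open>Three configurations suffice. The zero configuration puts \<open>c\<close> in the ideal.
  The point mass at 0 is fixed, so \<open>translate k\<close> acts trivially on point masses modulo
  the ideal. The point mass at 1 gains a point at 0, which puts a monomial in the ideal.\<close>

lemma affine_mod_controlled_not_imp_singleton:
  assumes D: "finite D" "D \<noteq> {}" and aff: "affine_mod D (toggle_if 0 (agree (\<lambda>_. True) {1}))"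
  shows "\<exists>a. D = {a}"
proof -
  let ?h = "toggle_if 0 (agree (\<lambda>_. True) {1})"
  let ?\<delta> = "\<lambda>m j. j = (m::int)"
  obtain k c where h: "\<And>x. ideal_cong D (?h x) (\<lambda>j. translate k x j \<noteq> c j)"
    using aff unfolding affine_mod_def by blast
  have h_simps: "?h (\<lambda>_. False) = (\<lambda>_. False)" "?h (?\<delta> 0) = ?\<delta> 0" "?h (?\<delta> 1) = (\<lambda>j. j = 0 \<or> j = 1)"
    by (auto simp: toggle_if_def agree_def fun_eq_iff)
  have c0: "ideal_cong D (\<lambda>_. False) c"
    using h[of "\<lambda>_. False"] h_simps by (simp add: translate_def)
  have lin: "ideal_cong D (?h x) (translate k x)" for x
  proof -
    have "ideal_cong D (\<lambda>j. c j \<noteq> translate k x j) (\<lambda>j. False \<noteq> translate k x j)"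
      by (intro ideal_cong_xor ideal_cong_sym[OF c0])
    moreover have "(\<lambda>j. c j \<noteq> translate k x j) = (\<lambda>j. translate k x j \<noteq> c j)" by auto
    ultimately have "ideal_cong D (\<lambda>j. translate k x j \<noteq> c j) (translate k x)"
      by simp
    with h show ?thesis by (rule ideal_cong_trans)
  qed
  have "ideal_cong D (translate (-1) (?\<delta> 0)) (translate (-1) (translate k (?\<delta> 0)))"
    using lin[of "?\<delta> 0"] h_simps by (intro ideal_cong_translate) simp
  moreover have "translate (-1) (?\<delta> 0) = ?\<delta> 1" "translate (-1) (translate k (?\<delta> 0)) = translate k (?\<delta> 1)"
    by (auto simp: translate_def)
  ultimately have "ideal_cong D (?\<delta> 1) (translate k (?\<delta> 1))" by simp
  moreover have "ideal_cong D (\<lambda>j. j = 0 \<or> j = 1) (translate k (?\<delta> 1))"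
    using lin[of "?\<delta> 1"] h_simps by simp
  ultimately have "ideal_cong D (\<lambda>j. j = 0 \<or> j = 1) (?\<delta> 1)"
    using ideal_cong_trans ideal_cong_sym by blast
  then show ?thesis
    by (rule ideal_cong_single_imp_singleton[OF D, of _ _ 0]) auto
qed

section \<open>Necessity: the differing coordinate is interior\<close>

text \<open>The sign \<open>s\<close> is \<open>1\<close> or \<open>-1\<close> and selects the direction from which agreement is measured.\<close>

definition agree_below :: "int \<Rightarrow> config \<Rightarrow> config \<Rightarrow> int \<Rightarrow> bool" where
  "agree_below s x y i \<longleftrightarrow> (\<forall>j. s * j \<le> i \<longrightarrow> x j = y j)"

text \<open>The equivalence makes any first disagreement, seen from the chosen side, move by exactly
  \<open>k\<close>, so a single pair of configurations can determine \<open>k\<close>.\<close>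

definition one_sided :: "int \<Rightarrow> (config \<Rightarrow> config) \<Rightarrow> bool" where
  "one_sided s g \<longleftrightarrow>
     (\<exists>k. \<forall>x y i. agree_below s x y i \<longleftrightarrow> agree_below s (g x) (g y) (i + k))"

lemma one_sided_comp:
  assumes "one_sided s g" "one_sided s h"
  shows "one_sided s (g \<circ> h)"
proof -
  obtain k where g: "\<And>x y i. agree_below s x y i \<longleftrightarrow> agree_below s (g x) (g y) (i + k)"
    using assms(1) unfolding one_sided_def by blast
  obtain l where h: "\<And>x y i. agree_below s x y i \<longleftrightarrow> agree_below s (h x) (h y) (i + l)"
    using assms(2) unfolding one_sided_def by blast
  have "agree_below s x y i \<longleftrightarrow> agree_below s ((g \<circ> h) x) ((g \<circ> h) y) (i + (l + k))" for x y i
    using g[of "h x" "h y" "i + l"] h[of x y i] by (simp add: add.assoc)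
  then show ?thesis unfolding one_sided_def by blast
qed

lemma one_sided_translate:
  shows "one_sided s (translate k)"
proof -
  have "agree_below s x y i \<longleftrightarrow> agree_below s (translate k x) (translate k y) (i + (- s * k))" for x y i
  proof
    assume "agree_below s x y i"
    then show "agree_below s (translate k x) (translate k y) (i + (- s * k))"
      by (auto simp: agree_below_def translate_def algebra_simps)
  next
    assume R: "agree_below s (translate k x) (translate k y) (i + (- s * k))"
    show "agree_below s x y i"
      unfolding agree_below_def
    proof (intro allI impI)
      fix j assume "s * j \<le> i"
      then have "s * (j - k) \<le> i + (- s * k)" by (simp add: algebra_simps)
      with R have "translate k x (j - k) = translate k y (j - k)"
        unfolding agree_below_def by blast
      then show "x j = y j" by (simp add: translate_def)
    qed
  qed
  then show ?thesis unfolding one_sided_def by blast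
qed

text \<open>The controls come before the target, so configurations agreeing as far as the target
  make the same decision there. The converse is the same fact for the images, the map being an
  involution.\<close>

lemma one_sided_toggle_if:
  assumes "\<And>j. j \<in> C \<Longrightarrow> s * j < s * a"
  shows "one_sided s (toggle_if a (agree w C))"
proof -
  let ?f = "toggle_if a (agree w C)"
  have "a \<notin> C" using assms by blast
  have *: "agree_below s (?f x) (?f y) i" if "agree_below s x y i" for x y i
    unfolding agree_below_def
  proof (intro allI impI)
    fix j assume j: "s * j \<le> i"
    have "agree w C x = agree w C y" if "j = a"
    proof (rule agree_cong)
      fix l assume "l \<in> C"
      then have "s * l \<le> i" using assms[of l] j that by auto
      then show "x l = y l" using \<open>agree_below s x y i\<close> unfolding agree_below_def by blast
    qed
    moreover have "x j = y j" using that j unfolding agree_below_def by blast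
    ultimately show "?f x j = ?f y j"
      by (auto simp: toggle_if_def)
  qed
  have "agree_below s x y i \<longleftrightarrow> agree_below s (?f x) (?f y) (i + 0)" for x y i
    using *[of x y i] *[of "?f x" "?f y" i] \<open>a \<notin> C\<close> by (auto simp: toggle_if_involution)
  then show ?thesis unfolding one_sided_def by blast
qed

text \<open>The zero configuration and the point mass at 0 are both fixed, which forces
  \<open>k = 0\<close>. The point mass at \<open>s\<close> agrees with zero up to index 0, but their
  images differ at 0.\<close>

lemma not_one_sided_controlled_not:
  assumes "s * s = 1"
  shows "\<not> one_sided s (toggle_if 0 (agree (\<lambda>_. True) {s}))"
proof
  let ?h = "toggle_if 0 (agree (\<lambda>_. True) {s})"
  let ?z = "\<lambda>_::int. False" and ?\<delta> = "\<lambda>m j. j = (m::int)"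
  assume "one_sided s ?h"
  then obtain k where k: "\<And>x y i. agree_below s x y i \<longleftrightarrow> agree_below s (?h x) (?h y) (i + k)"
    unfolding one_sided_def by blast
  have s0: "s \<noteq> 0" using assms by auto
  have hz: "?h ?z = ?z" "?h (?\<delta> 0) = ?\<delta> 0"
    using s0 by (auto simp: toggle_if_def agree_def fun_eq_iff)
  have "agree_below s ?z (?\<delta> 0) i \<longleftrightarrow> i < 0" for i
    by (auto simp: agree_below_def dest: spec[of _ 0])
  then have "(i < 0) = (i + k < 0)" for i using k[of ?z "?\<delta> 0" i] hz by simp
  from this[of "-1"] this[of 0] this[of "-k"] this[of "-k - 1"] have "k = 0" by auto
  moreover have "agree_below s ?z (?\<delta> s) 0" using assms by (auto simp: agree_below_def)
  ultimately have "agree_below s (?h ?z) (?h (?\<delta> s)) 0" using k[of ?z "?\<delta> s" 0] by simp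
  then have "?h ?z 0 = ?h (?\<delta> s) 0" unfolding agree_below_def by simp
  then show False using s0 by (simp add: toggle_if_def agree_def)
qed

lemma not_generated_if_one_sided:
  assumes len: "length u = length v" and s: "s * s = 1" and "one_sided s (swap_words u v)"
  shows "carrier G_group \<noteq> generate G_group {flip0, swap_words u v, shift}"
proof
  let ?h = "toggle_if 0 (agree (\<lambda>_. True) {s})"
  assume eq: "carrier G_group = generate G_group {flip0, swap_words u v, shift}"
  have "0 \<notin> {s}" using s by auto
  then have "?h \<in> generate G_group {flip0, swap_words u v, shift}"
    unfolding eq[symmetric] by (intro local_in_G_group toggle_if_local_homeo) auto
  then have "one_sided s ?h" using len
  proof (induction rule: generate_flip_swap_shift_induct)
    case id
    show ?case using one_sided_translate[of s 0] unfolding translate_0 .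
  next
    case flip0
    have "flip0 = toggle_if 0 (agree (\<lambda>_. True) {})"
      by (auto simp: flip0_def toggle_if_def agree_def)
    moreover have "one_sided s (toggle_if 0 (agree (\<lambda>_. True) {}))"
      by (rule one_sided_toggle_if) simp
    ultimately show ?case by (simp only:)
  qed (fact one_sided_translate assms(3) one_sided_comp)+
  with not_one_sided_controlled_not[OF s] show False by simp
qed

lemma single_diff_if_generated:
  assumes len: "length u = n" "length v = n" "u \<noteq> v"
    and eq: "carrier G_group = generate G_group {flip0, swap_words u v, shift}"
  shows "\<exists>a<n. \<forall>i<n. (u ! i \<noteq> v ! i) = (i = a)"
proof -
  define D where "D = int ` {i. i < n \<and> u ! i \<noteq> v ! i}"
  have "finite D" unfolding D_def by simp
  have "D \<noteq> {}" using len unfolding D_def by (auto simp: list_eq_iff_nth_eq)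
  \<comment> \<open>This gate lies in the full group; if the generators produced it, it would be
    affine modulo the ideal of the difference set.\<close>
  let ?h = "toggle_if 0 (agree (\<lambda>_. True) {1})"
  have "?h \<in> generate G_group {flip0, swap_words u v, shift}"
    unfolding eq[symmetric] by (intro local_in_G_group toggle_if_local_homeo) auto
  moreover have "length u = length v" using len by simp
  ultimately have "affine_mod D ?h"
  proof (induction rule: generate_flip_swap_shift_induct)
    case id
    show ?case using affine_mod_translate[of D 0] unfolding translate_0 .
  qed (fact affine_mod_translate affine_mod_flip0 affine_mod_comp
         affine_mod_swap_words[OF len(1,2) D_def])+
  then obtain a where "D = {a}"
    using affine_mod_controlled_not_imp_singleton \<open>finite D\<close> \<open>D \<noteq> {}\<close> by blast
  then obtain b where "a = int b" "b < n" unfolding D_def by blast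
  have "(u ! i \<noteq> v ! i) = (i = b)" if "i < n" for i
  proof -
    have "(u ! i \<noteq> v ! i) = (int i \<in> D)" using that unfolding D_def by auto
    then show ?thesis using \<open>D = {a}\<close> \<open>a = int b\<close> by simp
  qed
  with \<open>b < n\<close> show ?thesis by blast
qed

lemma diff_word_eq_iff:
  assumes "length u = n" "length v = n"
  shows "(\<exists>a b. a \<ge> 1 \<and> b \<ge> 1 \<and> diff_word u v = replicate a False @ [True] @ replicate b False)
    \<longleftrightarrow> (\<exists>a. 0 < a \<and> Suc a < n \<and> (\<forall>i<n. (u ! i \<noteq> v ! i) = (i = a)))"
    (is "?L \<longleftrightarrow> ?R")
proof
  assume ?L
  then obtain a b where ab: "a \<ge> 1" "b \<ge> 1"
    and d: "diff_word u v = replicate a False @ [True] @ replicate b False" by blast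
  have l: "n = a + 1 + b" using arg_cong[OF d, of length] assms by (simp add: diff_word_def)
  have "(u ! i \<noteq> v ! i) = (i = a)" if "i < n" for i
  proof -
    have "(u ! i \<noteq> v ! i) = diff_word u v ! i" using that assms by (simp add: diff_word_def)
    also have "\<dots> = (i = a)" using that l unfolding d by (auto simp: nth_append nth_Cons split: nat.split)
    finally show ?thesis .
  qed
  then show ?R using ab l by (intro exI[of _ a]) auto
next
  assume ?R
  then obtain a where a: "0 < a" "Suc a < n" "\<And>i. i < n \<Longrightarrow> (u ! i \<noteq> v ! i) = (i = a)" by blast
  have "diff_word u v = replicate a False @ [True] @ replicate (n - Suc a) False"
    using a assms
    by (intro nth_equalityI) (auto simp: diff_word_def nth_append nth_Cons split: nat.split)
  then show ?L using a by (intro exI[of _ a] exI[of _ "n - Suc a"]) auto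
qed

section \<open>Sufficiency: controlled flips generate the finite-window maps\<close>

lemma translate_toggle_if:
  "translate (- k) \<circ> toggle_if a P \<circ> translate k = toggle_if (a + k) (P \<circ> translate k)"
  by (auto simp: fun_eq_iff translate_def toggle_if_def)

text \<open>A word on \<open>W\<close> is encoded as the set of positions holding
  \<open>True\<close>. Permutations of words become permutations of \<open>Pow W\<close>, and
  changing a letter inserts or deletes an element.\<close>

definition act_on_window :: "int set \<Rightarrow> (int set \<Rightarrow> int set) \<Rightarrow> config \<Rightarrow> config" where
  "act_on_window W \<pi> x = (\<lambda>i. if i \<in> W then i \<in> \<pi> {j \<in> W. x j} else x i)"

lemma act_on_window_id: "act_on_window W id = id"
  by (auto simp: act_on_window_def fun_eq_iff)

lemma act_on_window_comp:
  assumes "\<And>A. A \<subseteq> W \<Longrightarrow> \<rho> A \<subseteq> W"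
  shows "act_on_window W (\<pi> \<circ> \<rho>) = act_on_window W \<pi> \<circ> act_on_window W \<rho>"
proof
  fix x
  have "{j \<in> W. act_on_window W \<rho> x j} = \<rho> {j \<in> W. x j}"
    using assms[of "{j \<in> W. x j}"] by (auto simp: act_on_window_def)
  then show "act_on_window W (\<pi> \<circ> \<rho>) x = (act_on_window W \<pi> \<circ> act_on_window W \<rho>) x"
    by (auto simp: act_on_window_def fun_eq_iff)
qed

text \<open>An edge of the hypercube of words is a flip controlled by all the other positions of the
  window.\<close>

lemma act_on_window_transpose_adjacent:
  assumes "A \<subseteq> W" "i \<in> W" "i \<notin> A"
  shows "act_on_window W (Transposition.transpose A (insert i A)) =
    toggle_if i (agree (\<lambda>j. j \<in> A) (W - {i}))"
proof
  fix x
  let ?X = "{j \<in> W. x j}"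
  have ag: "agree (\<lambda>j. j \<in> A) (W - {i}) x \<longleftrightarrow> ?X = A \<or> ?X = insert i A"
    using assms by (auto simp: agree_def)
  show "act_on_window W (Transposition.transpose A (insert i A)) x =
    toggle_if i (agree (\<lambda>j. j \<in> A) (W - {i})) x"
  proof (cases "x i")
    case True
    then have "?X \<noteq> A" using assms by blast
    then show ?thesis
      using True assms ag
      by (cases "?X = insert i A") (auto simp: act_on_window_def toggle_if_def fun_eq_iff)
  next
    case False
    then have "?X \<noteq> insert i A" by blast
    then show ?thesis
      using False assms ag
      by (cases "?X = A") (auto simp: act_on_window_def toggle_if_def fun_eq_iff)
  qed
qed

section \<open>Calculus of controlled flips\<close>

locale gate_closed =
  fixes H :: "(config \<Rightarrow> config) set"
  assumes comp_in: "g \<in> H \<Longrightarrow> h \<in> H \<Longrightarrow> g \<circ> h \<in> H"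
    and flip0_in: "flip0 \<in> H"
    and translate_in: "translate k \<in> H"
begin

lemma id_in: "id \<in> H"
  using translate_in[of 0] by (simp add: translate_0)

lemma flip_in: "toggle_if a (\<lambda>_. True) \<in> H"
proof -
  have "translate (- a) \<circ> toggle_if 0 (\<lambda>_. True) \<circ> translate a \<in> H"
    by (intro comp_in translate_in flip0_in[unfolded flip0_eq_toggle_if])
  then show ?thesis unfolding translate_toggle_if by (simp add: o_def)
qed

text \<open>Quantifying over all patterns reduces the later constructions to bookkeeping of control
  sets.\<close>

definition controls :: "int set \<Rightarrow> int \<Rightarrow> bool" where
  "controls C a \<longleftrightarrow> a \<notin> C \<and> (\<forall>w. toggle_if a (agree w C) \<in> H)"

lemma controls_if_toggle_in:
  assumes C: "finite C" "a \<notin> C" and w0: "toggle_if a (agree w\<^sub>0 C) \<in> H"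
  shows "controls C a"
proof -
  \<comment> \<open>\<open>F\<close> collects the positions where the pattern has been negated;
    conjugating by the flip at a control position negates one more.\<close>
  have "toggle_if a (agree (\<lambda>j. w\<^sub>0 j \<noteq> (j \<in> F)) C) \<in> H" if "F \<subseteq> C" for F
    using finite_subset[OF that C(1)] that
  proof (induction F rule: finite_induct)
    case empty
    then show ?case using w0 by simp
  next
    case (insert j F)
    let ?w = "\<lambda>j. w\<^sub>0 j \<noteq> (j \<in> F)" and ?flip = "toggle_if j (\<lambda>_. True)"
    have "j \<noteq> a" using insert C by auto
    have "agree (\<lambda>l. w\<^sub>0 l \<noteq> (l \<in> insert j F)) C x \<longleftrightarrow> agree ?w C (x(j := \<not> x j))" for x
      using insert by (auto simp: agree_def)
    then have "toggle_if a (agree (\<lambda>l. w\<^sub>0 l \<noteq> (l \<in> insert j F)) C) =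
        ?flip \<circ> toggle_if a (agree ?w C) \<circ> ?flip"
      using \<open>j \<noteq> a\<close> by (auto simp: toggle_if_def fun_eq_iff)
    then show ?case using insert by (simp only:) (intro comp_in flip_in, simp)
  qed
  from this[of "{j \<in> C. w j \<noteq> w\<^sub>0 j}" for w]
  have in_H: "toggle_if a (agree (\<lambda>j. w\<^sub>0 j \<noteq> (j \<in> C \<and> w j \<noteq> w\<^sub>0 j)) C) \<in> H" for w
    by simp
  have "agree (\<lambda>j. w\<^sub>0 j \<noteq> (j \<in> C \<and> w j \<noteq> w\<^sub>0 j)) C = agree w C" for w
    by (auto simp: agree_def fun_eq_iff)
  with in_H C show ?thesis unfolding controls_def by simp
qed

lemma controls_translate:
  assumes "controls C a"
  shows "controls ((\<lambda>j. j + k) ` C) (a + k)"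
  unfolding controls_def
proof (intro conjI allI)
  show "a + k \<notin> (\<lambda>j. j + k) ` C" using assms by (auto simp: controls_def)
  fix w
  have "agree (translate k w) C \<circ> translate k = agree w ((\<lambda>j. j + k) ` C)"
    by (auto simp: agree_def translate_def fun_eq_iff)
  moreover have "translate (- k) \<circ> toggle_if a (agree (translate k w) C) \<circ> translate k \<in> H"
    using assms by (intro comp_in translate_in) (simp add: controls_def)
  ultimately show "toggle_if (a + k) (agree w ((\<lambda>j. j + k) ` C)) \<in> H"
    by (simp add: translate_toggle_if)
qed

text \<open>Composing the gates for both required values at \<open>j\<close> drops that control:
  when the other controls are met, exactly one of the two fires.\<close>

lemma controls_remove:
  assumes "controls C a"
  shows "controls (C - {j}) a"
proof (cases "j \<in> C")
  case True
  have a: "a \<notin> C" using assms by (simp add: controls_def)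
  have "toggle_if a (agree w (C - {j})) =
      toggle_if a (agree w C) \<circ> toggle_if a (agree (w(j := \<not> w j)) C)" for w
  proof -
    have "agree w (C - {j}) x = (agree w C x \<noteq> agree (w(j := \<not> w j)) C x)" for x
      using True by (auto simp: agree_def)
    then show ?thesis using a by (auto simp: toggle_if_def fun_eq_iff agree_upd)
  qed
  then show ?thesis using assms by (auto simp: controls_def intro!: comp_in)
next
  case False
  then show ?thesis using assms by simp
qed

lemma controls_subset:
  assumes "controls C a" "finite C" "C' \<subseteq> C"
  shows "controls C' a"
proof -
  have "controls (C - F) a" if "finite F" for F
    using that
  proof (induction F rule: finite_induct)
    case (insert j F)
    have "C - insert j F = C - F - {j}" by auto
    then show ?case using controls_remove[OF insert(3)] by metis
  qed (simp add: assms)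
  from this[of "C - C'"] show ?thesis using assms by (simp add: double_diff)
qed

text \<open>When \<open>A\<close> is met, the two flips of \<open>s\<close> see opposite values of
  \<open>t\<close>, so exactly one fires if \<open>B\<close> is met too. When \<open>A\<close> or
  \<open>B\<close> fails, they cancel or do nothing. The two toggles of \<open>t\<close> undo each
  other, as flipping \<open>s\<close> does not affect \<open>A\<close>.\<close>

lemma controls_commutator:
  assumes t: "controls A t" and s: "controls (insert t B) s" and new: "s \<notin> A" "t \<notin> B"
  shows "controls (A \<union> B) s"
  unfolding controls_def
proof (intro conjI allI)
  have notin: "t \<notin> A" "s \<notin> B" "s \<noteq> t" using t s by (auto simp: controls_def)
  then show "s \<notin> A \<union> B" using new by simp
  fix w
  \<comment> \<open>Since \<open>t\<close> lies outside \<open>A\<close> and \<open>B\<close>, the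
    pattern may demand \<open>True\<close> there whatever \<open>w t\<close> is.\<close>
  let ?T = "toggle_if t (agree w A)" and ?S = "toggle_if s (agree (w(t := True)) (insert t B))"
  have "agree (w(t := True)) (insert t B) x \<longleftrightarrow> x t \<and> agree w B x" for x
    using new by (auto simp: agree_def)
  moreover have "agree w (A \<union> B) x \<longleftrightarrow> agree w A x \<and> agree w B x" for x
    by (auto simp: agree_def)
  ultimately have "toggle_if s (agree w (A \<union> B)) = ?S \<circ> ?T \<circ> ?S \<circ> ?T"
    using notin new
    by (auto simp: toggle_if_def fun_eq_iff agree_upd)
  then show "toggle_if s (agree w (A \<union> B)) \<in> H"
    using t s by (auto simp: controls_def intro!: comp_in)
qed

section \<open>From neighbouring controls to arbitrary finite control sets\<close>

context
  assumes neighbours: "\<And>i. controls {i - 1, i + 1} i"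
begin

text \<open>The control moves outwards one place at a time: a commutator with empty \<open>B\<close>
  replaces it by its own right neighbour.\<close>

lemma controls_single_right: "controls {i + 1 + int d} i"
proof (induction d)
  case 0
  show ?case using controls_subset[OF neighbours[of i]] by simp
next
  case (Suc d)
  have "controls {i + 1 + int (Suc d)} (i + 1 + int d)"
    using controls_subset[OF neighbours[of "i + 1 + int d"]] by (simp add: add.commute)
  with Suc show ?case
    using controls_commutator[of "{i + 1 + int (Suc d)}" "i + 1 + int d" "{}" i] by simp
qed

lemma controls_single_left: "controls {i - 1 - int d} i"
proof (induction d)
  case 0
  show ?case using controls_subset[OF neighbours[of i]] by simp
next
  case (Suc d)
  have "controls {i - 1 - int (Suc d)} (i - 1 - int d)"
    using controls_subset[OF neighbours[of "i - 1 - int d"]] by (simp add: algebra_simps)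
  with Suc show ?case
    using controls_commutator[of "{i - 1 - int (Suc d)}" "i - 1 - int d" "{}" i] by simp
qed

lemma controls_single: "i \<noteq> j \<Longrightarrow> controls {j} i"
  using controls_single_right[of i "nat (j - i - 1)"] controls_single_left[of i "nat (i - j - 1)"]
  by (cases "i < j") auto

text \<open>The double control is built at a distant \<open>t\<close>, where both neighbours are
  available: \<open>q\<close> replaces \<open>t + 1\<close>, then \<open>p\<close> replaces
  \<open>t - 1\<close>. A single control from \<open>t\<close> then hands the result over to
  \<open>s\<close>.\<close>

lemma controls_pair:
  assumes "s \<noteq> p" "s \<noteq> q"
  shows "controls {p, q} s"
proof -
  \<comment> \<open>The margin 2 keeps both neighbours of \<open>t\<close> away from
    \<open>p\<close> and \<open>q\<close> as well.\<close>
  define t where "t = \<bar>p\<bar> + \<bar>q\<bar> + \<bar>s\<bar> + 2"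
  have t: "t \<noteq> p" "t \<noteq> q" "t \<noteq> s" "t - 1 \<noteq> p" "t - 1 \<noteq> q" "t + 1 \<noteq> p" "t + 1 \<noteq> q"
    unfolding t_def by linarith+
  have "controls ({q} \<union> {t - 1}) t"
    using t neighbours[of t] by (intro controls_commutator[of _ "t + 1"] controls_single)
      (auto simp: insert_commute)
  then have "controls ({p} \<union> {q}) t"
    using t by (intro controls_commutator[of _ "t - 1"] controls_single) (auto simp: insert_commute)
  then have "controls (({p} \<union> {q}) \<union> {}) s"
    using t assms by (intro controls_commutator[of "{p} \<union> {q}" t "{}"]) (auto intro: controls_single)
  then show ?thesis by (simp add: insert_commute)
qed

text \<open>A fresh \<open>t\<close> serves as scratch position: the induction hypothesis lets
  \<open>C\<close> control \<open>t\<close>, the pair of \<open>t\<close> and \<open>c\<close>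
  controls \<open>s\<close>, and the commutator restores \<open>t\<close>.\<close>

lemma controls_all:
  assumes "finite C" "s \<notin> C"
  shows "controls C s"
  using assms
proof (induction C arbitrary: s rule: finite_induct)
  case empty
  show ?case using controls_subset[OF neighbours[of s], of "{}"] by simp
next
  case (insert c C)
  obtain t where t: "t \<notin> insert s (insert c C)"
    using ex_new_if_finite[OF infinite_UNIV_int] insert(1) by (metis finite_insert)
  have "controls (C \<union> {c}) s"
    using t insert by (intro controls_commutator[of _ t] controls_pair) auto
  then show ?case by simp
qed

section \<open>Permutations of the words on a finite window\<close>

lemma act_on_window_transpose_in:
  assumes W: "finite W" and A: "A \<subseteq> W" and B: "B \<subseteq> W"
  shows "act_on_window W (Transposition.transpose A B) \<in> H"
proof -
  have adjacent: "act_on_window W (Transposition.transpose B (insert i B)) \<in> H"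
    if "B \<subseteq> W" "i \<in> W" "i \<notin> B" for B i
    unfolding act_on_window_transpose_adjacent[OF that]
    using controls_all[of "W - {i}" i] W by (simp add: controls_def)
  \<comment> \<open>This walks along a path in the hypercube: \<open>S\<close> is the set of letters
    of \<open>A\<close> changed so far, and the symmetric difference is the word reached.\<close>
  have "act_on_window W (Transposition.transpose A ((A - S) \<union> (S - A))) \<in> H" if "S \<subseteq> W" for S
    using finite_subset[OF that W] that
  proof (induction S rule: finite_induct)
    case empty
    have "Transposition.transpose A ((A - {}) \<union> ({} - A)) = id"
      by (simp add: transpose_eq_id_iff)
    then show ?case by (simp only: act_on_window_id id_in)
  next
    case (insert i S)
    let ?B' = "(A - S) \<union> (S - A)" and ?B = "(A - insert i S) \<union> (insert i S - A)"
    have sub: "?B' \<subseteq> W" "?B \<subseteq> W" "i \<in> W" using insert A by auto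
    have step: "act_on_window W (Transposition.transpose ?B ?B') \<in> H"
    proof (cases "i \<in> A")
      case True
      then have "?B' = insert i ?B" "i \<notin> ?B" using insert by auto
      then show ?thesis using adjacent[OF sub(2,3)] by (simp only: not_False_eq_True)
    next
      case False
      then have "?B = insert i ?B'" "i \<notin> ?B'" using insert by auto
      then show ?thesis using adjacent[OF sub(1,3)] by (simp only: transpose_commute not_False_eq_True)
    qed
    show ?case
    proof (cases "S = {}")
      case True
      then have "?B' = A" by auto
      then show ?thesis using step by (simp only: transpose_commute)
    next
      case False
      then have "?B' \<noteq> A" "?B \<noteq> A" by auto
      \<comment> \<open>Conjugating by the edge from \<open>?B'\<close> to \<open>?B\<close> moves
        the far end of the transposition. Both must differ from \<open>A\<close>, hence the separate
        case of the first edge.\<close>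
      then have eq: "Transposition.transpose A ?B = Transposition.transpose ?B ?B' \<circ>
          (Transposition.transpose ?B' A \<circ> Transposition.transpose ?B ?B')"
        using transpose_comp_triple[of ?B A ?B']
        by (simp only: transpose_commute comp_assoc not_False_eq_True simp_thms)
      have tr: "Transposition.transpose X Y Z \<subseteq> W" if "X \<subseteq> W" "Y \<subseteq> W" "Z \<subseteq> W" for X Y Z
        using that by (simp add: Transposition.transpose_def)
      have "act_on_window W (Transposition.transpose A ?B) =
          act_on_window W (Transposition.transpose ?B ?B') \<circ>
          (act_on_window W (Transposition.transpose ?B' A) \<circ>
           act_on_window W (Transposition.transpose ?B ?B'))"
        unfolding eq using sub A
        by (subst act_on_window_comp, simp add: tr)+ (rule refl)
      moreover have "act_on_window W (Transposition.transpose ?B' A) \<in> H"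
        using insert by (subst transpose_commute) simp
      ultimately show ?thesis using step by (simp only:) (intro comp_in)
    qed
  qed
  from this[of "(A - B) \<union> (B - A)"]
  have "act_on_window W (Transposition.transpose A
      ((A - ((A - B) \<union> (B - A))) \<union> (((A - B) \<union> (B - A)) - A))) \<in> H"
    using A B by blast
  moreover have "(A - ((A - B) \<union> (B - A))) \<union> (((A - B) \<union> (B - A)) - A) = B" by blast
  ultimately show ?thesis by (simp only:)
qed

lemma act_on_window_permutation_in:
  assumes W: "finite W" and \<pi>: "\<pi> permutes Pow W"
  shows "act_on_window W \<pi> \<in> H"
  using \<pi> finite_Pow_iff[THEN iffD2, OF W]
proof (induction rule: permutes_induct)
  case id
  show ?case unfolding act_on_window_id by (rule id_in)
next
  case (swap A B p)
  have "p X \<subseteq> W" if "X \<subseteq> W" for X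
    using permutes_in_image[OF \<open>p permutes Pow W\<close>, of X] that by simp
  then have "act_on_window W (Transposition.transpose A B \<circ> p) =
      act_on_window W (Transposition.transpose A B) \<circ> act_on_window W p"
    by (rule act_on_window_comp)
  moreover have "act_on_window W (Transposition.transpose A B) \<in> H"
    using swap W by (intro act_on_window_transpose_in) auto
  ultimately show ?case using swap by (simp only: comp_in)
qed

lemma finite_window_map_in:
  assumes W: "finite W" and inj: "inj h"
    and outside: "\<And>x i. i \<notin> W \<Longrightarrow> h x i = x i"
    and dep: "\<And>x y i. i \<in> W \<Longrightarrow> (\<And>j. j \<in> W \<Longrightarrow> x j = y j) \<Longrightarrow> h x i = h y i"
  shows "h \<in> H"
proof -
  \<comment> \<open>Positions outside \<open>W\<close> are filled with \<open>False\<close>, which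
    by \<open>dep\<close> does not influence the result on \<open>W\<close>. Injectivity of
    \<open>h\<close> passes to words because \<open>h\<close> changes nothing outside
    \<open>W\<close>, and on the finite \<open>Pow W\<close> it yields a permutation.\<close>
  define \<pi> where "\<pi> A = (if A \<subseteq> W then {i \<in> W. h (\<lambda>j. j \<in> A) i} else A)" for A
  have "inj_on \<pi> (Pow W)"
  proof (rule inj_onI)
    fix A B assume AB: "A \<in> Pow W" "B \<in> Pow W" and eq: "\<pi> A = \<pi> B"
    have "h (\<lambda>j. j \<in> A) i = h (\<lambda>j. j \<in> B) i" for i
    proof (cases "i \<in> W")
      case True
      then show ?thesis using eq AB by (auto simp: \<pi>_def set_eq_iff)
    next
      case False
      then show ?thesis using AB by (auto simp: outside)
    qed
    then have "(\<lambda>j. j \<in> A) = (\<lambda>j. j \<in> B)"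
      using inj by (auto dest: injD)
    then show "A = B" by (auto simp: fun_eq_iff)
  qed
  moreover have "\<pi> ` Pow W \<subseteq> Pow W" by (auto simp: \<pi>_def)
  ultimately have "bij_betw \<pi> (Pow W) (Pow W)"
    using W by (simp add: bij_betw_def endo_inj_surj)
  then have "\<pi> permutes Pow W"
    by (rule bij_imp_permutes) (auto simp: \<pi>_def)
  then have "act_on_window W \<pi> \<in> H" by (rule act_on_window_permutation_in[OF W])
  moreover have "act_on_window W \<pi> = h"
  proof (intro ext)
    fix x i
    have "{j \<in> W. x j} \<subseteq> W" by auto
    then show "act_on_window W \<pi> x i = h x i"
      using dep[of i "\<lambda>j. j \<in> {j \<in> W. x j}" x] outside
      by (auto simp: act_on_window_def \<pi>_def)
  qed
  ultimately show ?thesis by simp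
qed

end

end

section \<open>Compactness: local homeomorphisms act on finite windows\<close>

lemma continuous_map_full_shift_finite_dependence:
  assumes "continuous_map full_shift full_shift h"
  shows "\<exists>N. finite N \<and> (\<forall>x y. (\<forall>j\<in>N. x j = y j) \<longrightarrow> h x i = h y i)"
proof -
  have cont: "continuous_map full_shift (discrete_topology UNIV) (\<lambda>x. h x i)"
    using assms unfolding full_shift_def by (simp add: continuous_map_componentwise_UNIV)
  have "\<exists>F. finite F \<and> (\<forall>y. (\<forall>j\<in>F. y j = x j) \<longrightarrow> h y i = h x i)" for x
  proof -
    have "openin full_shift {y. h y i \<in> {h x i}}"
      using openin_continuous_map_preimage[OF cont, of "{h x i}"] by simp
    then obtain U where U: "finite {j. U j \<noteq> UNIV}" "x \<in> Pi\<^sub>E UNIV U"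
        "Pi\<^sub>E UNIV U \<subseteq> {y. h y i \<in> {h x i}}"
      unfolding full_shift_def openin_product_topology_alt by auto
    have "h y i = h x i" if "\<forall>j\<in>{j. U j \<noteq> UNIV}. y j = x j" for y
    proof -
      have "y j \<in> U j" for j
        using that U(2) by (cases "U j = UNIV") auto
      then show ?thesis using U(3) by auto
    qed
    with U(1) show ?thesis by blast
  qed
  then obtain F where F: "\<And>x. finite (F x)" "\<And>x y. (\<And>j. j \<in> F x \<Longrightarrow> y j = x j) \<Longrightarrow> h y i = h x i"
    by metis
  \<comment> \<open>On \<open>cyl x\<close> the output at \<open>i\<close> is constant. Finitely
    many such cylinders cover the compact space, and the union of their coordinate sets works
    uniformly.\<close>
  define cyl where "cyl x = {y. \<forall>j\<in>F x. y j = x j}" for x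
  have "openin full_shift (cyl x)" for x
  proof -
    define U where "U j = (if j \<in> F x then {x j} else UNIV)" for j
    have "cyl x = Pi\<^sub>E UNIV U"
      by (auto simp: cyl_def U_def PiE_iff split: if_splits)
    moreover have "finite {j \<in> UNIV. U j \<noteq> topspace (discrete_topology UNIV)}"
      by (rule finite_subset[OF _ F(1)[of x]]) (auto simp: U_def)
    ultimately show ?thesis
      unfolding full_shift_def by (simp add: openin_PiE_gen)
  qed
  moreover have "compact_space full_shift"
    unfolding full_shift_def
    by (auto simp: compact_space_product_topology compact_space_discrete_topology)
  moreover have "x \<in> cyl x" for x by (simp add: cyl_def)
  ultimately obtain \<F> where \<F>: "finite \<F>" "\<F> \<subseteq> range cyl" "UNIV \<subseteq> \<Union>\<F>"
    unfolding compact_space_alt topspace_full_shift by (metis (no_types, lifting) UN_I UNIV_I imageE subsetI)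
  then obtain X where X: "finite X" "\<F> = cyl ` X"
    by (meson finite_subset_image)
  have "h y i = h z i" if "\<forall>j\<in>(\<Union>x\<in>X. F x). y j = z j" for y z
  proof -
    obtain x where x: "x \<in> X" "y \<in> cyl x" using \<F>(3) X(2) by blast
    then have "\<And>j. j \<in> F x \<Longrightarrow> y j = x j" "\<And>j. j \<in> F x \<Longrightarrow> z j = x j"
      using that by (auto simp: cyl_def)
    then show ?thesis using F(2) by metis
  qed
  with X(1) F(1) show ?thesis by (intro exI[of _ "\<Union>x\<in>X. F x"]) auto
qed

lemma local_homeo_finite_window:
  assumes "h \<in> local_homeos"
  obtains W where "finite W" "\<And>x i. i \<notin> W \<Longrightarrow> h x i = x i"
    "\<And>x y i. i \<in> W \<Longrightarrow> (\<And>j. j \<in> W \<Longrightarrow> x j = y j) \<Longrightarrow> h x i = h y i"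
proof -
  obtain r :: nat where r: "\<And>x i. \<bar>i\<bar> \<ge> int r \<Longrightarrow> h x i = x i"
    using assms unfolding local_homeos_def by blast
  have "continuous_map full_shift full_shift h"
    using assms by (auto simp: local_homeos_def homeo_group_def homeomorphic_imp_continuous_map)
  then obtain N where N: "\<And>i. finite (N i)"
      "\<And>i x y. (\<And>j. j \<in> N i \<Longrightarrow> x j = y j) \<Longrightarrow> h x i = h y i"
    using continuous_map_full_shift_finite_dependence by metis
  \<comment> \<open>\<open>W\<close> holds all coordinates that may change and all those they depend
    on. The other coordinates of \<open>W\<close> just keep their own values.\<close>
  define W where "W = {- int r<..<int r} \<union> (\<Union>i\<in>{- int r<..<int r}. N i)"
  show thesis
  proof (rule that)
    show "finite W" unfolding W_def using N(1) by auto
    show "h x i = x i" if "i \<notin> W" for x i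
      using that by (intro r) (auto simp: W_def)
    show "h x i = h y i" if i: "i \<in> W" and eq: "\<And>j. j \<in> W \<Longrightarrow> x j = y j" for x y i
    proof (cases "\<bar>i\<bar> \<ge> int r")
      case True
      then show ?thesis using r eq[OF i] by simp
    next
      case False
      then have "i \<in> {- int r<..<int r}" by auto
      then have "N i \<subseteq> W" unfolding W_def by blast
      then show ?thesis using eq by (intro N(2)) auto
    qed
  qed
qed

text \<open>Local homeomorphisms have local inverses, so only the inverse of \<open>shift\<close>
  has to be supplied separately.\<close>

lemma G_group_subset:
  assumes local: "local_homeos \<subseteq> H" and shift: "shift \<in> H" "translate (-1) \<in> H"
    and comp: "\<And>g h. g \<in> H \<Longrightarrow> h \<in> H \<Longrightarrow> g \<circ> h \<in> H"
  shows "carrier G_group \<subseteq> H"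
proof
  fix g assume "g \<in> carrier G_group"
  then have "g \<in> generate homeo_group (insert shift local_homeos)" by (simp add: G_group_def)
  then show "g \<in> H"
  proof (induction rule: generate.induct)
    case one
    have "shift \<circ> translate (-1) \<in> H" by (intro comp shift)
    moreover have "shift \<circ> translate (-1) = id"
      by (simp add: shift_eq_translate fun_eq_iff translate_translate translate_0)
    ultimately show ?case unfolding homeo_group_simps by metis
  next
    case (incl h)
    then show ?case using local shift by auto
  next
    case (inv h)
    then show ?case
    proof
      assume "h = shift"
      have "inv\<^bsub>homeo_group\<^esub> shift = translate (-1)"
      proof (rule group.inv_equality[OF group_homeo_group])
        show "translate (-1) \<in> carrier homeo_group"
          using translate_neg_one_in_G_group G_group_subset_homeo_group by blast
        show "shift \<in> carrier homeo_group" by (rule shift_in_homeo_group)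
      qed (simp add: homeo_group_simps fun_eq_iff shift_eq_translate translate_translate translate_0)
      then show ?thesis using shift \<open>h = shift\<close> by simp
    next
      assume h: "h \<in> local_homeos"
      then have hc: "h \<in> carrier homeo_group" by (simp add: local_homeos_def)
      let ?k = "inv\<^bsub>homeo_group\<^esub> h"
      have k: "?k \<in> carrier homeo_group" "h \<circ> ?k = id"
        using group.inv_closed[OF group_homeo_group hc] group.r_inv[OF group_homeo_group hc]
        by (simp_all add: homeo_group_simps)
      obtain r :: nat where "\<And>x i. \<bar>i\<bar> \<ge> int r \<Longrightarrow> h x i = x i"
        using h unfolding local_homeos_def by blast
      then have "\<bar>i\<bar> \<ge> int r \<Longrightarrow> ?k x i = x i" for x i
        using k(2) by (metis comp_apply id_apply)
      with k(1) have "?k \<in> local_homeos" unfolding local_homeos_def by blast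
      then show ?thesis using local by blast
    qed
  next
    case (eng h1 h2)
    then show ?case unfolding homeo_group_simps by (intro comp)
  qed
qed

section \<open>The two directions for the concrete generators\<close>

lemma generated_if_interior_single_diff:
  assumes len: "length u = n" "length v = n" and a: "0 < a" "Suc a < n"
    and diff: "\<forall>i<n. (u ! i \<noteq> v ! i) = (i = a)"
  shows "carrier G_group = generate G_group {flip0, swap_words u v, shift}" (is "_ = ?H")
proof
  have sub: "{flip0, swap_words u v, shift} \<subseteq> carrier G_group"
    using flip0_in_G_group shift_in_G_group swap_words_in_G_group[of u v] len by auto
  then show "?H \<subseteq> carrier G_group"
    by (rule group.generate_incl[OF group_G_group])
  have comp: "g \<circ> h \<in> ?H" if "g \<in> ?H" "h \<in> ?H" for g h
    using generate.eng[OF that] by (simp add: G_group_simps)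
  have t1: "translate 1 \<in> ?H"
    unfolding shift_eq_translate[symmetric] by (intro generate.incl) simp
  have t2: "translate (-1) \<in> ?H"
    unfolding inv_shift[symmetric] by (intro generate.inv) simp
  have tnat: "translate (int k) \<in> ?H \<and> translate (- int k) \<in> ?H" for k
  proof (induction k)
    case 0
    then show ?case
      using generate.one[of G_group "{flip0, swap_words u v, shift}"]
      unfolding of_nat_0 minus_zero translate_0 G_group_simps by blast
  next
    case (Suc k)
    have "translate (int (Suc k)) = translate 1 \<circ> translate (int k)"
      "translate (- int (Suc k)) = translate (-1) \<circ> translate (- int k)"
      by (auto simp: fun_eq_iff translate_translate)
    with Suc comp t1 t2 show ?case by metis
  qed
  interpret gate_closed ?H
  proof
    show "translate k \<in> ?H" for k
      using tnat[of "nat k"] tnat[of "nat (- k)"] by (cases "0 \<le> k") auto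
    show "flip0 \<in> ?H" by (intro generate.incl) simp
  qed (rule comp)
  have "a < n" using a by simp
  have "toggle_if (int a) (agree (\<lambda>i. u ! nat i) ({0..<int n} - {int a})) \<in> ?H"
    unfolding swap_words_eq_toggle_if[OF len \<open>a < n\<close> diff, symmetric]
    by (intro generate.incl) simp
  then have "controls ({0..<int n} - {int a}) (int a)"
    by (intro controls_if_toggle_in) auto
  \<comment> \<open>As \<open>a\<close> is interior, both neighbours are among the controls of the
    swap; all others are dropped.\<close>
  then have "controls {int a - 1, int a + 1} (int a)"
    by (rule controls_subset) (use a in auto)
  then have "controls {i - 1, i + 1} i" for i
    using controls_translate[of "{int a - 1, int a + 1}" "int a" "i - int a"]
    by (simp add: add.commute)
  note in_H = finite_window_map_in[OF this]
  have "local_homeos \<subseteq> ?H"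
  proof
    fix h assume h: "h \<in> local_homeos"
    then have "inj h"
      by (auto simp: local_homeos_def homeo_group_def dest: homeomorphic_imp_injective_map)
    with local_homeo_finite_window[OF h] show "h \<in> ?H"
      by (metis in_H)
  qed
  then show "carrier G_group \<subseteq> ?H"
    by (rule G_group_subset) (use t1 t2 comp in \<open>auto simp: shift_eq_translate\<close>)
qed

theorem theorem2:
  fixes n :: nat and u v :: "bool list"
  assumes "length u = n" and "length v = n" and "u \<noteq> v"
  shows "carrier G_group = generate G_group {flip0, swap_words u v, shift} \<longleftrightarrow>
    (\<exists>a b. a \<ge> 1 \<and> b \<ge> 1 \<and>
       diff_word u v = replicate a False @ [True] @ replicate b False)"
  unfolding diff_word_eq_iff[OF assms(1,2)]
proof
  assume eq: "carrier G_group = generate G_group {flip0, swap_words u v, shift}"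
  then obtain a where a: "a < n" "\<forall>i<n. (u ! i \<noteq> v ! i) = (i = a)"
    using single_diff_if_generated[OF assms] by blast
  note swap = swap_words_eq_toggle_if[OF assms(1,2) a]
  have len: "length u = length v" using assms by simp
  have "a \<noteq> 0"
  proof
    assume "a = 0"
    \<comment> \<open>With the target at the left end every control lies to its right, so agreement
      is measured from the right.\<close>
    then have "one_sided (-1) (swap_words u v)"
      unfolding swap by (intro one_sided_toggle_if) auto
    with not_generated_if_one_sided[OF len, of "-1"] eq show False by simp
  qed
  moreover have "Suc a \<noteq> n"
  proof
    assume "Suc a = n"
    then have "one_sided 1 (swap_words u v)"
      unfolding swap by (intro one_sided_toggle_if) auto
    with not_generated_if_one_sided[OF len, of 1] eq show False by simp
  qed
  ultimately show "\<exists>a. 0 < a \<and> Suc a < n \<and> (\<forall>i<n. (u ! i \<noteq> v ! i) = (i = a))"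
    using a by (intro exI[of _ a]) auto
next
  assume "\<exists>a. 0 < a \<and> Suc a < n \<and> (\<forall>i<n. (u ! i \<noteq> v ! i) = (i = a))"
  then show "carrier G_group = generate G_group {flip0, swap_words u v, shift}"
    using generated_if_interior_single_diff[OF assms(1,2)] by blast
qed

end
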